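(* Let $(X(t),V(t))=(\{x_j(t)\}_{j=1}^J,\{v_j(t)\}_{j=1}^J)$ be a classical solution, starting at time $t=0$, of the second-order EKI system $$\dot x_j=v_j,\qquad \dot v_j=-\gamma v_j+\beta\, C^{xG}(X)\Gamma^{-1}\bigl(y-G(x_j)\bigr)+k\sum_{i\neq j}f(\|x_i-x_j\|)(x_j-x_i)-\alpha(x_j-\bar x),\qquad j=1,\dots,J,$$ where the forward map $G:\mathbb R^d\to\mathbb R^K$ is continuous and possibly nonlinear. Define $\tilde x_j(t):=x_j(t)-\bar x(t)$, $\tilde v_j(t):=v_j(t)-\bar v(t)$, and $$\mathcal S_0:=\operatorname{span}\{\tilde x_j(0),\tilde v_j(0): j=1,\dots,J\}.$$ Then $\tilde x_j(t),\tilde v_j(t)\in\mathcal S_0$ for all $j=1,\dots,J$ and for every time $t$ for which the solution exists. Moreover, defining $$\mathcal V_0:=\mathcal S_0+\operatorname{span}\{\bar v(0)\}=\operatorname{span}\{\tilde x_j(0),v_j(0): j=1,\dots,J\},$$ we have $x_j(t)\in\bar x(0)+\mathcal V_0$ and $v_j(t)\in\mathcal V_0$ for all $j=1,\dots,J$ and every such $t$.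
   Context: Positions $x_j(t)\in\mathbb R^d$ and velocities $v_j(t)\in\mathbb R^d$, $j=1,\dots,J$. Bars denote ensemble means: $\bar x=\frac1J\sum_j x_j$, $\bar v=\frac1J\sum_j v_j$, $\bar G=\frac1J\sum_j G(x_j)$. The empirical cross-covariance is $C^{xG}(X)=\frac1J\sum_{j=1}^J (x_j-\bar x)(G(x_j)-\bar G)^T\in\mathbb R^{d\times K}$. Data: $y\in\mathbb R^K$; $\Gamma\in\mathbb R^{K\times K}$ symmetric positive definite. Parameters: $\gamma>0$, $\beta>0$, $k\ge0$, $\alpha\ge0$. The interaction kernel $f:[0,\infty)\to(0,\infty)$ is smooth and non-increasing. $\|\cdot\|$ is the Euclidean norm. A classical solution is a continuously differentiable pair $(X,V)$ satisfying the system pointwise on an interval starting at $t=0$. *)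

theory Defs
  imports "HOL-Analysis.Analysis"
begin

text \<open>An ensemble is a family indexed by a finite type \<open>'j\<close>, so that \<open>J = CARD('j)\<close>;
  trajectories are time-dependent ensembles, with \<open>x t j\<close> the position of particle \<open>j\<close>
  at time \<open>t\<close>.\<close>

definition ens_mean :: "('j::finite \<Rightarrow> 'a::real_vector) \<Rightarrow> 'a"
  where "ens_mean z = (1 / real CARD('j)) *\<^sub>R (\<Sum>j\<in>UNIV. z j)"

definition ens_dev :: "('j::finite \<Rightarrow> 'a::real_vector) \<Rightarrow> 'j \<Rightarrow> 'a"
  where "ens_dev z j = z j - ens_mean z"

definition outer :: "real ^ 'd \<Rightarrow> real ^ 'k \<Rightarrow> real ^ 'k ^ 'd"
  where "outer a b = (\<chi> p q. a $ p * b $ q)"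

definition cross_cov ::
    "(real ^ 'd \<Rightarrow> real ^ 'k) \<Rightarrow> ('j::finite \<Rightarrow> real ^ 'd) \<Rightarrow> real ^ 'k ^ 'd"
  where "cross_cov G X = ens_mean (\<lambda>j. outer (ens_dev X j) (ens_dev (\<lambda>i. G (X i)) j))"

definition sym_pos_def :: "real ^ 'k ^ 'k \<Rightarrow> bool"
  where "sym_pos_def A \<longleftrightarrow> transpose A = A \<and> (\<forall>z. z \<noteq> 0 \<longrightarrow> z \<bullet> (A *v z) > 0)"

text \<open>A kernel on \<open>[0,\<infinity>)\<close> is a function on \<open>real\<close> of which only the values on \<open>{0..}\<close>
  matter. Smoothness means derivatives of every order, one-sided at the endpoint;
  \<open>F n\<close> below is the derivative of order \<open>n\<close>.\<close>

definition smooth_on_nonneg :: "(real \<Rightarrow> real) \<Rightarrow> bool"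
  where "smooth_on_nonneg f \<longleftrightarrow>
    (\<exists>F :: nat \<Rightarrow> real \<Rightarrow> real. (\<forall>r\<ge>0. F 0 r = f r) \<and>
      (\<forall>n. \<forall>r\<ge>0. (F n has_real_derivative F (Suc n) r) (at r within {0..})))"

definition interaction_kernel :: "(real \<Rightarrow> real) \<Rightarrow> bool"
  where "interaction_kernel f \<longleftrightarrow>
    smooth_on_nonneg f \<and> (\<forall>r\<ge>0. f r > 0) \<and> antimono_on {0..} f"

definition eki_accel ::
    "real \<Rightarrow> real \<Rightarrow> real \<Rightarrow> real \<Rightarrow> (real \<Rightarrow> real) \<Rightarrow> real ^ 'k ^ 'k \<Rightarrow> real ^ 'k
     \<Rightarrow> (real ^ 'd \<Rightarrow> real ^ 'k) \<Rightarrow> ('j::finite \<Rightarrow> real ^ 'd) \<Rightarrow> ('j \<Rightarrow> real ^ 'd) \<Rightarrow> 'j \<Rightarrow> real ^ 'd"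
  where "eki_accel \<gamma> \<beta> k \<alpha> f \<Gamma> y G X V j =
    - \<gamma> *\<^sub>R V j
    + \<beta> *\<^sub>R ((cross_cov G X ** matrix_inv \<Gamma>) *v (y - G (X j)))
    + k *\<^sub>R (\<Sum>i\<in>UNIV - {j}. f (norm (X i - X j)) *\<^sub>R (X j - X i))
    - \<alpha> *\<^sub>R (X j - ens_mean X)"

definition interval_from_0 :: "real set \<Rightarrow> bool"
  where "interval_from_0 T \<longleftrightarrow> is_interval T \<and> 0 \<in> T \<and> T \<subseteq> {0..}"

text \<open>Derivatives are taken within \<open>T\<close>, hence one-sided at an endpoint belonging to \<open>T\<close>;
  for this reason the library's \<open>C1_differentiable_on\<close>, which is two-sided, is not used.\<close>

definition C1_within :: "real set \<Rightarrow> (real \<Rightarrow> 'a::real_normed_vector) \<Rightarrow> bool"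
  where "C1_within T g \<longleftrightarrow>
    (\<exists>g'. continuous_on T g' \<and> (\<forall>t\<in>T. (g has_vector_derivative g' t) (at t within T)))"

definition eki_classical_solution ::
    "real \<Rightarrow> real \<Rightarrow> real \<Rightarrow> real \<Rightarrow> (real \<Rightarrow> real) \<Rightarrow> real ^ 'k ^ 'k \<Rightarrow> real ^ 'k
     \<Rightarrow> (real ^ 'd \<Rightarrow> real ^ 'k) \<Rightarrow> real set
     \<Rightarrow> (real \<Rightarrow> 'j::finite \<Rightarrow> real ^ 'd) \<Rightarrow> (real \<Rightarrow> 'j \<Rightarrow> real ^ 'd) \<Rightarrow> bool"
  where "eki_classical_solution \<gamma> \<beta> k \<alpha> f \<Gamma> y G T x v \<longleftrightarrow>
    interval_from_0 T \<and>
    (\<forall>j. C1_within T (\<lambda>t. x t j) \<and> C1_within T (\<lambda>t. v t j)) \<and>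
    (\<forall>t\<in>T. \<forall>j.
      ((\<lambda>s. x s j) has_vector_derivative v t j) (at t within T) \<and>
      ((\<lambda>s. v s j) has_vector_derivative eki_accel \<gamma> \<beta> k \<alpha> f \<Gamma> y G (x t) (v t) j) (at t within T))"

definition dev_span :: "('j::finite \<Rightarrow> 'a::real_vector) \<Rightarrow> ('j \<Rightarrow> 'a) \<Rightarrow> 'a set"
  where "dev_span X V = span (range (ens_dev X) \<union> range (ens_dev V))"

definition state_span :: "('j::finite \<Rightarrow> 'a::real_vector) \<Rightarrow> ('j \<Rightarrow> 'a) \<Rightarrow> 'a set"
  where "state_span X V = {s + w | s w. s \<in> dev_span X V \<and> w \<in> span {ens_mean V}}"

end

theory Submission
  imports Defs
begin

text \<open>The Kalman gain, the interaction and the confinement are all linear combinations of the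
  deviations \<open>x\<^sub>i - mean x\<close>, with coefficients that depend continuously on the ensemble. Along a given
  solution both the deviations and the shifted states \<open>(x\<^sub>j - mean (x 0), v\<^sub>j)\<close> therefore solve
  a linear second-order system with scalar time-dependent coefficients. Testing such a system against
  any vector orthogonal to the initial data gives a scalar linear system with zero initial data,
  which vanishes by Gronwall's argument.\<close>

section \<open>Gronwall's argument and linear second-order systems\<close>

text \<open>The weighted energy \<open>E t = exp (- 2 * M * t) * (z t \<bullet> z t)\<close> has
  nonpositive derivative by Cauchy-Schwarz and \<open>bound\<close>, and it starts at 0. Only its
  values at 0 and \<tau> are compared, so one application of the mean value theorem
  suffices.\<close>

lemma gronwall_vanish:
  fixes z :: "real \<Rightarrow> 'a::real_inner"
  assumes "0 \<le> \<tau>"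
    and deriv: "\<And>t. t \<in> {0..\<tau>} \<Longrightarrow> (z has_vector_derivative z' t) (at t within {0..\<tau>})"
    and bound: "\<And>t. t \<in> {0..\<tau>} \<Longrightarrow> norm (z' t) \<le> M * norm (z t)"
    and "z 0 = 0"
  shows "z \<tau> = 0"
proof (cases "\<tau> = 0")
  case False
  define E where "E t = exp (- 2 * M * t) * (z t \<bullet> z t)" for t
  define E' where "E' t = exp (- 2 * M * t) * (2 * (z t \<bullet> z' t) - 2 * M * (z t \<bullet> z t))" for t
  have "(E has_derivative (\<lambda>h. h * E' t)) (at t within {0..\<tau>})" if "t \<in> {0..\<tau>}" for t
    unfolding E_def E'_def
    by (rule has_derivative_eq_rhs, (rule derivative_intros deriv[OF that, unfolded has_vector_derivative_def])+)
      (auto simp: inner_commute algebra_simps)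
  then obtain s where s: "s \<in> {0<..<\<tau>}" "E \<tau> - E 0 = (\<tau> - 0) * E' s"
    using mvt_simple[of 0 \<tau> E "\<lambda>t h. h * E' t"] False \<open>0 \<le> \<tau>\<close> by auto
  have "z s \<bullet> z' s \<le> norm (z s) * norm (z' s)"
    by (rule norm_cauchy_schwarz)
  also have "\<dots> \<le> norm (z s) * (M * norm (z s))"
    using s by (intro mult_left_mono bound) auto
  also have "\<dots> = M * (z s \<bullet> z s)"
    by (simp add: dot_square_norm power2_eq_square)
  finally have "E' s \<le> 0"
    by (simp add: E'_def mult_le_0_iff)
  then have "E \<tau> \<le> 0"
    using s \<open>z 0 = 0\<close> by (simp add: E_def mult_le_0_iff)
  then have "z \<tau> \<bullet> z \<tau> \<le> 0"
    by (simp add: E_def mult_le_0_iff)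
  then show ?thesis
    by (metis inner_gt_zero_iff not_le)
qed (use \<open>z 0 = 0\<close> in simp)

lemma has_vector_derivative_vec_lambda:
  fixes f :: "real \<Rightarrow> 'i::finite \<Rightarrow> real"
  assumes "\<And>i. ((\<lambda>t. f t i) has_vector_derivative f' i) (at t within S)"
  shows "((\<lambda>t. \<chi> i. f t i) has_vector_derivative (\<chi> i. f' i)) (at t within S)"
  using assms unfolding has_vector_derivative_def
  by (subst has_derivative_componentwise_within) (auto simp: Basis_vec_def inner_axis)

text \<open>Split \<open>w\<close> into \<open>p\<close> in the span and \<open>u\<close> orthogonal
  to it. Then \<open>u\<close> is itself an admissible test vector, so
  \<open>u \<bullet> u = u \<bullet> w = 0\<close>.\<close>

lemma in_span_if_orthogonal:
  fixes w :: "'a::euclidean_space"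
  assumes "\<And>u. (\<And>s. s \<in> S \<Longrightarrow> u \<bullet> s = 0) \<Longrightarrow> u \<bullet> w = 0"
  shows "w \<in> span S"
proof -
  obtain p u where p: "p \<in> span S" and u: "\<And>s. s \<in> span S \<Longrightarrow> orthogonal u s" and "w = p + u"
    using orthogonal_subspace_decomp_exists[of S w] by metis
  have "u \<bullet> w = 0"
    using u by (intro assms) (simp add: orthogonal_def span_base)
  then have "u = 0"
    using u[OF p] \<open>w = p + u\<close> by (simp add: orthogonal_def inner_add_right)
  then show ?thesis
    using p \<open>w = p + u\<close> by simp
qed

text \<open>Since the coefficients are scalars, the inner product with a fixed \<open>u\<close>
  passes through the system: the numbers \<open>u \<bullet> x t j\<close> and
  \<open>u \<bullet> v t j\<close> solve a closed system with the same coefficients.\<close>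

lemma second_order_linear_in_span:
  fixes x v :: "real \<Rightarrow> 'j::finite \<Rightarrow> 'a::euclidean_space"
    and c :: "real \<Rightarrow> 'j \<Rightarrow> 'j \<Rightarrow> real"
  assumes T: "interval_from_0 T"
    and dx: "\<And>t j. t \<in> T \<Longrightarrow> ((\<lambda>s. x s j) has_vector_derivative v t j) (at t within T)"
    and dv: "\<And>t j. t \<in> T \<Longrightarrow> ((\<lambda>s. v s j) has_vector_derivative
               - \<gamma> *\<^sub>R v t j + (\<Sum>i\<in>UNIV. c t j i *\<^sub>R x t i)) (at t within T)"
    and c: "\<And>j i. continuous_on T (\<lambda>t. c t j i)"
    and "\<tau> \<in> T"
  shows "x \<tau> j \<in> span (range (x 0) \<union> range (v 0)) \<and> v \<tau> j \<in> span (range (x 0) \<union> range (v 0))"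
proof -
  have "0 \<le> \<tau>" and sub: "{0..\<tau>} \<subseteq> T"
    using T \<open>\<tau> \<in> T\<close> mem_is_interval_1_I[of T 0 \<tau>] by (auto simp: interval_from_0_def)
  \<comment> \<open>\<open>T\<close> may be unbounded or lack its right endpoint; on the compact
    interval up to \<tau> the continuous coefficients are bounded.\<close>
  have "compact ((\<lambda>t. c t j i) ` {0..\<tau>})" for j i
    using c sub by (intro compact_continuous_image) (auto intro: continuous_on_subset)
  then have "\<forall>j i. \<exists>B. \<forall>t\<in>{0..\<tau>}. \<bar>c t j i\<bar> \<le> B"
    by (metis compact_imp_bounded bounded_iff imageI real_norm_def)
  then obtain B where B: "\<And>t j i. t \<in> {0..\<tau>} \<Longrightarrow> \<bar>c t j i\<bar> \<le> B j i"
    by metis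
  have vanish: "u \<bullet> x \<tau> j = 0 \<and> u \<bullet> v \<tau> j = 0"
    if u: "\<And>s. s \<in> range (x 0) \<union> range (v 0) \<Longrightarrow> u \<bullet> s = 0" for u j
  proof -
    define a where "a t = (\<chi> j. u \<bullet> x t j)" for t
    define b where "b t = (\<chi> j. u \<bullet> v t j)" for t
    define b' where "b' t = (\<chi> j. - \<gamma> * (u \<bullet> v t j) + (\<Sum>i\<in>UNIV. c t j i * (u \<bullet> x t i)))" for t
    \<comment> \<open>The sum over \<open>j\<close> arises because \<open>norm (b' t)\<close> is
      bounded by its l1 norm, one row of coefficients per component. The 1 accounts for the
      derivative \<open>b\<close> of \<open>a\<close>.\<close>
    define M where "M = 1 + (\<Sum>j\<in>UNIV. \<bar>\<gamma>\<bar> + (\<Sum>i\<in>UNIV. B j i))"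
    note dinner = bounded_linear.has_vector_derivative[OF bounded_linear_inner_right[of u]]
    have da: "(a has_vector_derivative b t) (at t within {0..\<tau>})" if "t \<in> {0..\<tau>}" for t
      unfolding a_def b_def
      by (intro has_vector_derivative_vec_lambda dinner has_vector_derivative_within_subset[OF dx])
        (use that sub in auto)
    have db: "(b has_vector_derivative b' t) (at t within {0..\<tau>})" if "t \<in> {0..\<tau>}" for t
    proof -
      have "((\<lambda>t. u \<bullet> v t j) has_vector_derivative u \<bullet>
          (- \<gamma> *\<^sub>R v t j + (\<Sum>i\<in>UNIV. c t j i *\<^sub>R x t i))) (at t within {0..\<tau>})" for j
        by (intro dinner has_vector_derivative_within_subset[OF dv]) (use that sub in auto)
      then show ?thesis
        unfolding b_def b'_def
        by (intro has_vector_derivative_vec_lambda) (simp add: inner_diff_right inner_sum_right)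
    qed
    have b'_bound: "norm (b' t) \<le> (M - 1) * norm (a t, b t)" if t: "t \<in> {0..\<tau>}" for t
    proof -
      have "\<bar>u \<bullet> x t i\<bar> \<le> norm (a t, b t)" "\<bar>u \<bullet> v t i\<bar> \<le> norm (a t, b t)" for i
        using component_le_norm_cart[of "a t" i] component_le_norm_cart[of "b t" i]
          norm_fst_le[of "a t" "b t"] norm_snd_le[of "b t" "a t"] by (auto simp: a_def b_def)
      then have "\<bar>b' t $ j\<bar> \<le> \<bar>\<gamma>\<bar> * norm (a t, b t) + (\<Sum>i\<in>UNIV. B j i * norm (a t, b t))" for j
        unfolding b'_def vec_lambda_beta
        by (intro order_trans[OF abs_triangle_ineq] add_mono order_trans[OF sum_abs] sum_mono)
          (auto simp: abs_mult intro!: mult_mono mult_left_mono B t order_trans[OF abs_ge_zero B[OF t]])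
      then have "(\<Sum>j\<in>UNIV. \<bar>b' t $ j\<bar>) \<le> (M - 1) * norm (a t, b t)"
        unfolding M_def by (auto simp: sum_distrib_right distrib_right intro!: sum_mono)
      then show ?thesis
        using norm_le_l1_cart[of "b' t"] by linarith
    qed
    have "(a \<tau>, b \<tau>) = 0"
    proof (rule gronwall_vanish[where z = "\<lambda>t. (a t, b t)" and z' = "\<lambda>t. (b t, b' t)" and M = M])
      fix t assume t: "t \<in> {0..\<tau>}"
      show "((\<lambda>t. (a t, b t)) has_vector_derivative (b t, b' t)) (at t within {0..\<tau>})"
        using da[OF t] db[OF t] by (rule has_vector_derivative_Pair)
      have "norm (b t, b' t) \<le> norm (b t) + norm (b' t)"
        by (rule norm_Pair_le)
      also have "norm (b t) \<le> norm (a t, b t)"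
        by (rule norm_snd_le)
      finally show "norm (b t, b' t) \<le> M * norm (a t, b t)"
        using b'_bound[OF t] by (simp add: algebra_simps)
    qed (use \<open>0 \<le> \<tau>\<close> u in \<open>auto simp: a_def b_def zero_prod_def vec_eq_iff\<close>)
    then show ?thesis
      by (simp add: a_def b_def zero_prod_def vec_eq_iff)
  qed
  then show ?thesis
    by (intro conjI in_span_if_orthogonal) blast+
qed

section \<open>Algebra and calculus of ensemble deviations\<close>

lemma ens_mean_diff_const: "ens_mean (\<lambda>j. z j - a) = ens_mean z - a"
  for z :: "'j::finite \<Rightarrow> 'a::real_vector"
  by (simp add: ens_mean_def sum_subtractf algebra_simps sum_constant_scaleR)

lemma ens_dev_diff_const: "ens_dev (\<lambda>j. z j - a) = ens_dev z"
  by (simp add: fun_eq_iff ens_dev_def ens_mean_diff_const)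

text \<open>The vectors \<open>w i\<close> do not depend on the particle \<open>j\<close>, so
  centring in \<open>j\<close> acts on the coefficients alone. This keeps the system for the
  deviations linear with scalar coefficients.\<close>

lemma ens_dev_linear_combination:
  fixes w :: "'j::finite \<Rightarrow> 'a::real_vector"
  shows "ens_dev (\<lambda>j. r *\<^sub>R z j + (\<Sum>i\<in>UNIV. c j i *\<^sub>R w i)) j
    = r *\<^sub>R ens_dev z j + (\<Sum>i\<in>UNIV. ens_dev (\<lambda>j. c j i) j *\<^sub>R w i)"
proof -
  have "(\<Sum>j\<in>UNIV. \<Sum>i\<in>UNIV. c j i *\<^sub>R w i) = (\<Sum>i\<in>UNIV. (\<Sum>j\<in>UNIV. c j i) *\<^sub>R w i)"
    by (subst sum.swap) (simp add: scaleR_sum_left)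
  then have "ens_mean (\<lambda>j. r *\<^sub>R z j + (\<Sum>i\<in>UNIV. c j i *\<^sub>R w i))
    = r *\<^sub>R ens_mean z + (\<Sum>i\<in>UNIV. ens_mean (\<lambda>j. c j i) *\<^sub>R w i)"
    by (simp add: ens_mean_def sum.distrib scaleR_add_right scaleR_sum_right mult.commute)
  then show ?thesis
    by (simp add: ens_dev_def scaleR_diff_right scaleR_diff_left sum_subtractf)
qed

text \<open>Both sides equal the sum of all \<open>c i *\<^sub>R w i\<close> minus
  \<open>CARD('j)\<close> times the product of the two means. This allows a combination of
  deviations to be read as a combination of the positions themselves.\<close>

lemma ens_dev_self_adjoint:
  fixes w :: "'j::finite \<Rightarrow> 'a::real_vector"
  shows "(\<Sum>i\<in>UNIV. ens_dev c i *\<^sub>R w i) = (\<Sum>i\<in>UNIV. c i *\<^sub>R ens_dev w i)"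
  unfolding ens_dev_def scaleR_diff_left scaleR_diff_right sum_subtractf
  by (simp add: ens_mean_def sum_divide_distrib
      flip: scaleR_sum_right scaleR_sum_left)

lemma ens_dev_has_vector_derivative:
  fixes z :: "real \<Rightarrow> 'j::finite \<Rightarrow> 'a::real_normed_vector"
  assumes "\<And>j. ((\<lambda>s. z s j) has_vector_derivative z' j) F"
  shows "((\<lambda>s. ens_dev (z s) j) has_vector_derivative ens_dev z' j) F"
  unfolding ens_dev_def ens_mean_def
  by (intro has_vector_derivative_diff has_vector_derivative_sum assms
      bounded_linear.has_vector_derivative[OF bounded_linear_scaleR_right])

lemma continuous_on_ens_dev:
  fixes z :: "'b::topological_space \<Rightarrow> 'j::finite \<Rightarrow> 'a::real_normed_vector"
  assumes "\<And>j. continuous_on S (\<lambda>s. z s j)"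
  shows "continuous_on S (\<lambda>s. ens_dev (z s) j)"
  unfolding ens_dev_def ens_mean_def by (intro continuous_intros assms)

section \<open>The acceleration as a combination of deviations\<close>

text \<open>Each rank-one term sends \<open>w\<close> to a multiple of its left factor, which is a
  deviation of \<open>X\<close>; the nonlinear map \<open>G\<close> enters only through the scalar
  weights.\<close>

lemma cross_cov_mult_vec:
  fixes G :: "real ^ 'd \<Rightarrow> real ^ 'k" and X :: "'j::finite \<Rightarrow> real ^ 'd"
  shows "cross_cov G X *v w =
    (\<Sum>i\<in>UNIV. ((1 / real CARD('j)) * (ens_dev (\<lambda>i. G (X i)) i \<bullet> w)) *\<^sub>R ens_dev X i)"
proof -
  have *: "(\<Sum>A\<in>UNIV. F A) *v w = (\<Sum>A\<in>UNIV. F A *v w)" for F :: "'j \<Rightarrow> real ^ 'k ^ 'd" and w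
    by (intro linear_sum linearI matrix_vector_mult_add_rdistrib) (simp add: scaleR_matrix_vector_assoc)
  have "outer a b *v w = (b \<bullet> w) *\<^sub>R a" for a :: "real ^ 'd" and b w :: "real ^ 'k"
    by (simp add: outer_def vec_eq_iff matrix_vector_mult_def inner_vec_def sum_distrib_left mult_ac)
  then show ?thesis
    by (simp add: cross_cov_def ens_mean_def scaleR_matrix_vector_assoc[symmetric] * scaleR_sum_right)
qed

text \<open>For \<open>i = j\<close> the term \<open>- k * f 0\<close> cancels against the summand \<open>l = j\<close>, which saves
  excluding \<open>j\<close> from the sum.\<close>

definition eki_coeff ::
    "real \<Rightarrow> real \<Rightarrow> real \<Rightarrow> (real \<Rightarrow> real) \<Rightarrow> real ^ 'k ^ 'k \<Rightarrow> real ^ 'k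
     \<Rightarrow> (real ^ 'd \<Rightarrow> real ^ 'k) \<Rightarrow> ('j::finite \<Rightarrow> real ^ 'd) \<Rightarrow> 'j \<Rightarrow> 'j \<Rightarrow> real"
  where "eki_coeff \<beta> k \<alpha> f \<Gamma> y G X j i =
    \<beta> * ((1 / real CARD('j)) * (ens_dev (\<lambda>i. G (X i)) i \<bullet> (matrix_inv \<Gamma> *v (y - G (X j)))))
    - k * f (norm (X i - X j))
    + (if i = j then k * (\<Sum>l\<in>UNIV. f (norm (X l - X j))) - \<alpha> else 0)"

text \<open>Apart from friction, every force is a combination of deviations: the Kalman term by
  \<open>cross_cov_mult_vec\<close>, the interaction because the mean cancels in
  \<open>X j - X i\<close>, the confinement by its form.\<close>

lemma eki_accel_eq:
  fixes X V :: "'j::finite \<Rightarrow> real ^ 'd"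
  shows "eki_accel \<gamma> \<beta> k \<alpha> f \<Gamma> y G X V j =
    - \<gamma> *\<^sub>R V j + (\<Sum>i\<in>UNIV. eki_coeff \<beta> k \<alpha> f \<Gamma> y G X j i *\<^sub>R ens_dev X i)"
proof -
  define p where "p i = (1 / real CARD('j)) * (ens_dev (\<lambda>i. G (X i)) i \<bullet> (matrix_inv \<Gamma> *v (y - G (X j))))"
    for i
  define q where "q i = f (norm (X i - X j))" for i
  \<comment> \<open>The added summand \<open>i = j\<close> is zero because its vector factor is
    \<open>X j - X j\<close>.\<close>
  have "(\<Sum>i\<in>UNIV - {j}. q i *\<^sub>R (X j - X i)) = (\<Sum>i\<in>UNIV. q i *\<^sub>R (X j - X i))"
    by (simp add: sum.remove[of UNIV j])
  also have "\<dots> = (\<Sum>i\<in>UNIV. q i *\<^sub>R (ens_dev X j - ens_dev X i))"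
    by (simp add: ens_dev_def)
  also have "\<dots> = (\<Sum>i\<in>UNIV. q i) *\<^sub>R ens_dev X j - (\<Sum>i\<in>UNIV. q i *\<^sub>R ens_dev X i)"
    by (simp add: scaleR_diff_right sum_subtractf scaleR_sum_left)
  finally have inter: "(\<Sum>i\<in>UNIV - {j}. q i *\<^sub>R (X j - X i)) = \<dots>" .
  have "(\<Sum>i\<in>UNIV. (if i = j then r else 0) *\<^sub>R ens_dev X i) = r *\<^sub>R ens_dev X j" for r
    by (simp add: if_distrib[of "\<lambda>c. c *\<^sub>R _"] cong: if_cong)
  then have "(\<Sum>i\<in>UNIV. (\<beta> * p i - k * q i + (if i = j then k * sum q UNIV - \<alpha> else 0)) *\<^sub>R ens_dev X i)
    = \<beta> *\<^sub>R (\<Sum>i\<in>UNIV. p i *\<^sub>R ens_dev X i) - k *\<^sub>R (\<Sum>i\<in>UNIV. q i *\<^sub>R ens_dev X i)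
      + (k * sum q UNIV - \<alpha>) *\<^sub>R ens_dev X j"
    by (simp add: scaleR_add_left scaleR_diff_left sum.distrib sum_subtractf scaleR_sum_right)
  then show ?thesis
    unfolding eki_accel_def eki_coeff_def p_def[symmetric] q_def[symmetric] inter
      matrix_vector_mul_assoc[symmetric] cross_cov_mult_vec
    by (simp add: algebra_simps flip: ens_dev_def)
qed

text \<open>Continuity of \<open>G\<close> and \<open>f\<close> turns a continuous trajectory into
  coefficients continuous in time, as \<open>second_order_linear_in_span\<close> requires.\<close>

lemma continuous_on_eki_coeff:
  fixes x :: "real \<Rightarrow> 'j::finite \<Rightarrow> real ^ 'd"
  assumes f: "continuous_on {0..} f" and G: "continuous_on UNIV G"
    and x: "\<And>j. continuous_on T (\<lambda>t. x t j)"
  shows "continuous_on T (\<lambda>t. eki_coeff \<beta> k \<alpha> f \<Gamma> y G (x t) j i)"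
proof -
  have G': "continuous_on T (\<lambda>t. G (x t i))" for i
    by (rule continuous_on_compose2[OF G x]) auto
  have f': "continuous_on T (\<lambda>t. f (norm (x t i - x t j)))" for i j
    by (rule continuous_on_compose2[OF f]) (auto intro!: continuous_intros x)
  have mv: "continuous_on T (\<lambda>t. matrix_inv \<Gamma> *v (y - G (x t j)))" for j
    by (intro bounded_linear.continuous_on[OF matrix_vector_mul_bounded_linear] continuous_intros G')
  show ?thesis
    unfolding eki_coeff_def
    by (cases "i = j") (auto intro!: continuous_intros continuous_on_ens_dev G' f' mv)
qed

lemma interaction_kernel_continuous_on: "continuous_on {0..} f" if "interaction_kernel f"
proof -
  obtain F where F: "\<And>r. 0 \<le> r \<Longrightarrow> F 0 r = f r"
    "\<And>n r. 0 \<le> r \<Longrightarrow> (F n has_real_derivative F (Suc n) r) (at r within {0..})"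
    using \<open>interaction_kernel f\<close> by (auto simp: interaction_kernel_def smooth_on_nonneg_def)
  have "continuous_on {0..} (F 0)"
    using F(2) by (auto intro!: DERIV_continuous_on)
  then show ?thesis
    by (rule continuous_on_eq) (simp add: F(1))
qed

section \<open>The state span and the invariance of both subspaces\<close>

text \<open>Each velocity is its deviation plus the mean, and the mean is a combination of
  velocities, so each generating set lies in the span of the other.\<close>

lemma state_span_eq: "state_span X V = span (range (ens_dev X) \<union> range V)"
  for X V :: "'j::finite \<Rightarrow> 'a::real_vector"
proof -
  let ?m = "ens_mean V"
  have "state_span X V = span (range (ens_dev X) \<union> range (ens_dev V) \<union> {?m})"
    unfolding state_span_def dev_span_def span_Un[of _ "{?m}"] by blast
  also have "\<dots> = span (range (ens_dev X) \<union> range V)"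
  proof (rule span_eq[THEN iffD2], intro conjI)
    let ?S = "span (range (ens_dev X) \<union> range V)"
    have V: "V j \<in> ?S" for j
      by (simp add: span_base)
    then have m: "?m \<in> ?S"
      unfolding ens_mean_def by (intro span_scale span_sum)
    show "range (ens_dev X) \<union> range (ens_dev V) \<union> {?m} \<subseteq> ?S"
      using m V by (auto intro: span_base simp: ens_dev_def[of V] span_diff)
  next
    let ?S = "span (range (ens_dev X) \<union> range (ens_dev V) \<union> {?m})"
    have "ens_dev V j + ?m \<in> ?S" for j
      by (intro span_add span_base) auto
    then show "range (ens_dev X) \<union> range V \<subseteq> ?S"
      by (auto simp: ens_dev_def[of V] intro: span_base)
  qed
  finally show ?thesis .
qed

theorem proposition2p2:
  fixes \<gamma> \<beta> k \<alpha> :: real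
    and f :: "real \<Rightarrow> real"
    and \<Gamma> :: "real ^ 'k ^ 'k"
    and y :: "real ^ 'k"
    and G :: "real ^ 'd \<Rightarrow> real ^ 'k"
    and T :: "real set"
    and x v :: "real \<Rightarrow> 'j::finite \<Rightarrow> real ^ 'd"
  assumes "\<gamma> > 0" and "\<beta> > 0" and "k \<ge> 0" and "\<alpha> \<ge> 0"
    and "interaction_kernel f"
    and "sym_pos_def \<Gamma>"
    and "continuous_on UNIV G"
    and "eki_classical_solution \<gamma> \<beta> k \<alpha> f \<Gamma> y G T x v"
  shows "(\<forall>t\<in>T. \<forall>j. ens_dev (x t) j \<in> dev_span (x 0) (v 0)
                   \<and> ens_dev (v t) j \<in> dev_span (x 0) (v 0))
    \<and> state_span (x 0) (v 0) = span (range (ens_dev (x 0)) \<union> range (v 0))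
    \<and> (\<forall>t\<in>T. \<forall>j. x t j \<in> (\<lambda>w. ens_mean (x 0) + w) ` state_span (x 0) (v 0)
                   \<and> v t j \<in> state_span (x 0) (v 0))"
proof -
  have T: "interval_from_0 T"
    and dx: "\<And>t j. t \<in> T \<Longrightarrow> ((\<lambda>s. x s j) has_vector_derivative v t j) (at t within T)"
    and dv: "\<And>t j. t \<in> T \<Longrightarrow> ((\<lambda>s. v s j) has_vector_derivative
        eki_accel \<gamma> \<beta> k \<alpha> f \<Gamma> y G (x t) (v t) j) (at t within T)"
    using assms by (auto simp: eki_classical_solution_def)
  \<comment> \<open>Evaluating the coefficients along the given solution makes them known functions
    of time, so the system becomes linear.\<close>
  define c where "c t = eki_coeff \<beta> k \<alpha> f \<Gamma> y G (x t)" for t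
  note accel = eki_accel_eq[where \<beta> = \<beta> and k = k and \<alpha> = \<alpha> and f = f and \<Gamma> = \<Gamma> and y = y and G = G
      and X = "x _", folded c_def]
  have "continuous_on T (\<lambda>t. x t j)" for j
    using dx by (auto intro: has_vector_derivative_continuous simp: continuous_on_eq_continuous_within)
  then have c: "continuous_on T (\<lambda>t. c t j i)" for j i
    unfolding c_def using assms by (intro continuous_on_eki_coeff interaction_kernel_continuous_on)
  \<comment> \<open>The unknowns are the deviations. Subtracting the mean acceleration centres the
    coefficients in the index \<open>j\<close> of the accelerated particle.\<close>
  have dev: "ens_dev (x t) j \<in> dev_span (x 0) (v 0) \<and> ens_dev (v t) j \<in> dev_span (x 0) (v 0)"
    if "t \<in> T" for t j
    unfolding dev_span_def
  proof (rule second_order_linear_in_span[OF T, where \<gamma> = \<gamma> and c = "\<lambda>t j i. ens_dev (\<lambda>j. c t j i) j"])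
    fix t j assume t: "t \<in> T"
    show "((\<lambda>s. ens_dev (x s) j) has_vector_derivative ens_dev (v t) j) (at t within T)"
      using dx[OF t] by (rule ens_dev_has_vector_derivative)
    show "((\<lambda>s. ens_dev (v s) j) has_vector_derivative
        - \<gamma> *\<^sub>R ens_dev (v t) j + (\<Sum>i\<in>UNIV. ens_dev (\<lambda>j. c t j i) j *\<^sub>R ens_dev (x t) i)) (at t within T)"
      unfolding ens_dev_linear_combination[symmetric] accel[symmetric]
      using dv[OF t] by (rule ens_dev_has_vector_derivative)
  qed (use that in \<open>auto intro: continuous_on_ens_dev c\<close>)
  \<comment> \<open>The shift is the initial mean, constant in time: the velocities are unchanged,
    and at time 0 the shifted positions are exactly the initial deviations.\<close>
  define m where "m = ens_mean (x 0)"
  have state: "x t j - m \<in> state_span (x 0) (v 0) \<and> v t j \<in> state_span (x 0) (v 0)"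
    if "t \<in> T" for t j
    unfolding state_span_eq ens_dev_def[of "x 0", abs_def] m_def[symmetric]
  proof (rule second_order_linear_in_span[OF T, where x = "\<lambda>t j. x t j - m" and \<gamma> = \<gamma> and c = "\<lambda>t j. ens_dev (c t j)"])
    fix t j assume t: "t \<in> T"
    show "((\<lambda>s. x s j - m) has_vector_derivative v t j) (at t within T)"
      using dx[OF t] by (simp add: has_vector_derivative_diff_const)
    show "((\<lambda>s. v s j) has_vector_derivative
        - \<gamma> *\<^sub>R v t j + (\<Sum>i\<in>UNIV. ens_dev (c t j) i *\<^sub>R (x t i - m))) (at t within T)"
      \<comment> \<open>Here the coefficients are centred in the summation index \<open>i\<close>.
        Moving the centring onto the positions makes \<open>m\<close> drop out and restores the
        deviations in the acceleration.\<close>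
      unfolding ens_dev_self_adjoint ens_dev_diff_const accel[symmetric] by (rule dv[OF t])
  qed (use that in \<open>auto intro: continuous_on_ens_dev c\<close>)
  have "x t j \<in> (\<lambda>w. ens_mean (x 0) + w) ` state_span (x 0) (v 0)" if "t \<in> T" for t j
    using state[OF that, of j] by (intro image_eqI[of _ _ "x t j - m"]) (auto simp: m_def)
  then show ?thesis
    using dev state state_span_eq by blast
qed

end
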